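(* Let $X$ be a normed linear space, and let $A\subseteq X$ be a nonempty bounded set. If $A$ is uniquely remotal and M-compact, then the derived set $A'$ is either empty, or M-compact and uniquely remotal.
   Context: For a nonempty bounded subset $A$ of a normed linear space $X$ and $x\in X$, put $D(x,A)=\sup_{a\in A}\|x-a\|$ and $F(x,A)=\{a\in A:\|x-a\|=D(x,A)\}$. The set $A$ is called uniquely remotal if $F(x,A)$ consists of exactly one point for every $x\in X$. A sequence $\{a_n\}$ in $A$ is called maximizing (in $A$) if there is some $x\in X$ with $\|x-a_n\|\to D(x,A)$ as $n\to\infty$. The set $A$ is called M-compact if every maximizing sequence in $A$ has a subsequence converging to an element of $A$. The derived set $A'$ is the set of all limit (accumulation) points of $A$ in $X$. *)

theory Defs
  imports "HOL-Analysis.Analysis"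
begin

text \<open>The notions below are intended for nonempty bounded sets \<open>A\<close>; otherwise the real supremum
  in \<open>far_dist\<close> is not meaningful.\<close>

definition far_dist :: "'a::real_normed_vector \<Rightarrow> 'a set \<Rightarrow> real" where
  "far_dist x A = (SUP a\<in>A. norm (x - a))"

definition farthest_points :: "'a::real_normed_vector \<Rightarrow> 'a set \<Rightarrow> 'a set" where
  "farthest_points x A = {a \<in> A. norm (x - a) = far_dist x A}"

definition uniquely_remotal :: "'a::real_normed_vector set \<Rightarrow> bool" where
  "uniquely_remotal A \<longleftrightarrow> (\<forall>x. \<exists>!a. a \<in> farthest_points x A)"

definition maximizing_seq :: "'a::real_normed_vector set \<Rightarrow> (nat \<Rightarrow> 'a) \<Rightarrow> bool" where
  "maximizing_seq A s \<longleftrightarrow>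
     (\<forall>n. s n \<in> A) \<and> (\<exists>x. (\<lambda>n. norm (x - s n)) \<longlonglongrightarrow> far_dist x A)"

definition M_compact :: "'a::real_normed_vector set \<Rightarrow> bool" where
  "M_compact A \<longleftrightarrow>
     (\<forall>s. maximizing_seq A s \<longrightarrow>
        (\<exists>r l. strict_mono r \<and> l \<in> A \<and> (s \<circ> r) \<longlonglongrightarrow> l))"

definition derived_set :: "'a::topological_space set \<Rightarrow> 'a set" where
  "derived_set A = {x. x islimpt A}"

end

theory Submission
  imports Defs
begin

text \<open>
  Let \<open>q x\<close> denote the unique farthest point of \<open>A\<close> from \<open>x\<close>. M-compactness makes the
  farthest-point problem well posed: every maximizing sequence for \<open>x\<close> converges to \<open>q x\<close>
  (lemma \<open>maximizing_tendsto_farthest\<close>). Since \<open>far_dist\<close> is nonexpansive in its first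
  argument, \<open>x\<^sub>n \<longlonglongrightarrow> x\<close> makes \<open>q x\<^sub>n\<close> a maximizing sequence for \<open>x\<close>, so \<open>q\<close> is continuous
  and its range is connected.

  If the range of \<open>q\<close> is a single point \<open>p\<close>, then \<open>p\<close> is farthest from itself, so \<open>A = {p}\<close>
  and the derived set is empty. Otherwise a connected set with more than one point has no
  isolated points, so every \<open>q x\<close> is a limit point of \<open>A\<close>. Hence \<open>A\<close> and its derived set
  have the same \<open>far_dist\<close>, attained at \<open>q x\<close> in both. Points of the derived set are
  approximable from \<open>A\<close>, so maximizing sequences of the derived set are shadowed by maximizing
  sequences of \<open>A\<close> and also converge to \<open>q x\<close>; applied to constant sequences, this gives
  uniqueness of the farthest point as well.
\<close>

lemma norm_diff_le_far_dist:
  assumes "bounded A" "a \<in> A"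
  shows "norm (x - a) \<le> far_dist x A"
proof -
  have "bounded ((\<lambda>a. x - a) ` A)"
    using assms(1) bounded_translation[of "uminus ` A" x] by (simp add: image_image)
  then have "bdd_above ((\<lambda>a. norm (x - a)) ` A)"
    by (auto simp: bounded_iff bdd_above_def)
  then show ?thesis
    unfolding far_dist_def using assms(2) by (rule cSUP_upper2) simp
qed

lemma far_dist_leI:
  assumes "A \<noteq> {}" "\<And>a. a \<in> A \<Longrightarrow> norm (x - a) \<le> d"
  shows "far_dist x A \<le> d"
  unfolding far_dist_def using assms by (rule cSUP_least)

lemma far_dist_nonexpansive:
  assumes "A \<noteq> {}" "bounded A"
  shows "\<bar>far_dist x A - far_dist y A\<bar> \<le> norm (x - y)"
proof -
  have "far_dist u A \<le> norm (u - v) + far_dist v A" for u v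
  proof (rule far_dist_leI[OF assms(1)])
    fix a assume "a \<in> A"
    then show "norm (u - a) \<le> norm (u - v) + far_dist v A"
      using norm_diff_le_far_dist[OF assms(2), of a v] norm_triangle_ineq[of "u - v" "v - a"]
      by simp
  qed
  from this[of x y] this[of y x] show ?thesis
    by (simp add: norm_minus_commute)
qed

text \<open>
  Otherwise a subsequence would stay away from the farthest point; it is still maximizing, so
  by M-compactness it clusters at some point of \<open>A\<close>, which is again farthest from \<open>x\<close>.
\<close>

lemma maximizing_tendsto_farthest:
  assumes "uniquely_remotal A" "M_compact A"
    and s: "\<And>n. s n \<in> A" and lim: "(\<lambda>n. norm (x - s n)) \<longlonglongrightarrow> far_dist x A"
    and p: "p \<in> farthest_points x A"
  shows "s \<longlonglongrightarrow> p"
proof (rule ccontr)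
  assume "\<not> s \<longlonglongrightarrow> p"
  then obtain e where "e > 0" and "\<not> (\<forall>\<^sub>F n in sequentially. dist (s n) p < e)"
    unfolding tendsto_iff by blast
  then have far: "infinite {n. dist (s n) p \<ge> e}"
    by (simp add: cofinite_eq_sequentially[symmetric] eventually_cofinite not_less)
  from infinite_enumerate[OF far] obtain r :: "nat \<Rightarrow> nat"
    where r: "strict_mono r" "\<forall>n. dist (s (r n)) p \<ge> e"
    by auto
  have lim_r: "(\<lambda>n. norm (x - (s \<circ> r) n)) \<longlonglongrightarrow> far_dist x A"
    using LIMSEQ_subseq_LIMSEQ[OF lim r(1)] by (simp add: o_def)
  then have "maximizing_seq A (s \<circ> r)"
    unfolding maximizing_seq_def using s by auto
  then obtain t l where t: "strict_mono t" "l \<in> A" "((s \<circ> r) \<circ> t) \<longlonglongrightarrow> l"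
    using assms(2) unfolding M_compact_def by blast
  have "(\<lambda>n. norm (x - ((s \<circ> r) \<circ> t) n)) \<longlonglongrightarrow> norm (x - l)"
    by (intro tendsto_intros t(3))
  moreover have "(\<lambda>n. norm (x - ((s \<circ> r) \<circ> t) n)) \<longlonglongrightarrow> far_dist x A"
    using LIMSEQ_subseq_LIMSEQ[OF lim_r t(1)] by (simp add: o_def)
  ultimately have "norm (x - l) = far_dist x A"
    by (rule LIMSEQ_unique)
  with t(2) p assms(1) have "l = p"
    unfolding uniquely_remotal_def farthest_points_def by blast
  with t(3) \<open>e > 0\<close> obtain n where "dist (((s \<circ> r) \<circ> t) n) p < e"
    unfolding tendsto_iff eventually_sequentially by blast
  with r(2) show False
    by (simp add: not_le[symmetric])
qed

lemma continuous_on_farthest_point: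
  fixes q :: "'a::real_normed_vector \<Rightarrow> 'a"
  assumes "A \<noteq> {}" "bounded A" "uniquely_remotal A" "M_compact A"
    and q: "\<And>x. q x \<in> farthest_points x A"
  shows "continuous_on UNIV q"
proof (rule continuous_on_sequentiallyI)
  fix u and x :: 'a assume u: "u \<longlonglongrightarrow> x"
  have q_dist: "norm (y - q y) = far_dist y A" for y
    using q[of y] by (simp add: farthest_points_def)
  \<comment> \<open>Replacing \<open>x\<close> by \<open>u n\<close> changes the distance to \<open>q (u n)\<close> and the value of \<open>far_dist\<close>
    by at most \<open>norm (u n - x)\<close> each, and for \<open>u n\<close> the two agree.\<close>
  have bound: "norm (norm (x - q (u n)) - far_dist x A) \<le> norm (u n - x) * 2" for n
  proof -
    have "\<bar>norm (x - q (u n)) - norm (u n - q (u n))\<bar> \<le> norm (u n - x)"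
      using norm_triangle_ineq3[of "x - q (u n)" "u n - q (u n)"]
      by (simp add: norm_minus_commute)
    then show ?thesis
      using far_dist_nonexpansive[OF assms(1,2), of "u n" x] q_dist[of "u n"] by simp
  qed
  have "(\<lambda>n. norm (u n - x)) \<longlonglongrightarrow> 0"
    using u by (simp add: tendsto_norm_zero_iff LIM_zero_iff)
  then have "(\<lambda>n. norm (x - q (u n)) - far_dist x A) \<longlonglongrightarrow> 0"
    by (rule tendsto_0_le[where K = 2]) (use bound in \<open>simp add: always_eventually\<close>)
  then have "(\<lambda>n. norm (x - q (u n))) \<longlonglongrightarrow> far_dist x A"
    by (rule LIM_zero_cancel)
  moreover have "q (u n) \<in> A" for n
    using q[of "u n"] by (simp add: farthest_points_def)
  ultimately show "(\<lambda>n. q (u n)) \<longlonglongrightarrow> q x"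
    by (intro maximizing_tendsto_farthest[OF assms(3,4) _ _ q])
qed

text \<open>
  A constant farthest-point map sends its value \<open>p\<close> to itself, so \<open>A\<close> has radius zero about \<open>p\<close>.
  Otherwise its connected range has no isolated points.
\<close>

lemma singleton_or_farthest_points_islimpt:
  fixes q :: "'a::real_normed_vector \<Rightarrow> 'a"
  assumes "A \<noteq> {}" "bounded A" "uniquely_remotal A" "M_compact A"
    and q: "\<And>x. q x \<in> farthest_points x A"
  shows "(\<exists>p. A = {p}) \<or> (\<forall>x. q x islimpt A)"
proof (cases "\<exists>p. range q = {p}")
  case True
  then obtain p where "q p = p"
    by (metis rangeI singletonD)
  with q[of p] have p: "p \<in> A" "far_dist p A = 0"
    by (auto simp: farthest_points_def)
  have "a = p" if "a \<in> A" for a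
    using norm_diff_le_far_dist[OF assms(2) that, of p] p(2) by simp
  with p(1) show ?thesis by blast
next
  case False
  have "connected (range q)"
    using continuous_on_farthest_point[OF assms]
    by (rule connected_continuous_image) (simp add: convex_connected)
  then have "q x islimpt range q" for x
    using False by (intro connected_imp_perfect) auto
  moreover have "range q \<subseteq> A"
    using q by (auto simp: farthest_points_def)
  ultimately show ?thesis
    by (meson islimpt_subset)
qed

text \<open>
  Perturbing a sequence in the closure by less than \<open>1/(n+1)\<close> produces a sequence in \<open>A\<close> with the
  same limiting behaviour, to which the well-posedness in \<open>A\<close> applies.
\<close>

lemma closure_maximizing_tendsto_farthest:
  assumes "uniquely_remotal A" "M_compact A"
    and s: "\<And>n. s n \<in> closure A" and lim: "(\<lambda>n. norm (x - s n)) \<longlonglongrightarrow> far_dist x A"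
    and p: "p \<in> farthest_points x A"
  shows "s \<longlonglongrightarrow> p"
proof -
  have "\<exists>a\<in>A. dist a (s n) < inverse (real (Suc n))" for n
    using s[of n] unfolding closure_approachable by simp
  then obtain a where a: "\<And>n. a n \<in> A" "\<And>n. dist (a n) (s n) < inverse (real (Suc n))"
    by metis
  have shadow: "(\<lambda>n. a n - s n) \<longlonglongrightarrow> 0"
    by (rule Lim_null_comparison[OF _ LIMSEQ_inverse_real_of_nat])
      (use a(2) in \<open>auto simp: dist_norm intro!: always_eventually less_imp_le\<close>)
  have "(\<lambda>n. norm (x - a n) - norm (x - s n)) \<longlonglongrightarrow> 0"
  proof (rule Lim_null_comparison[OF _ tendsto_norm_zero[OF shadow]])
    show "\<forall>\<^sub>F n in sequentially. norm (norm (x - a n) - norm (x - s n)) \<le> norm (a n - s n)"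
    proof (intro always_eventually allI)
      fix n
      show "norm (norm (x - a n) - norm (x - s n)) \<le> norm (a n - s n)"
        using norm_triangle_ineq3[of "x - a n" "x - s n"] by (simp add: norm_minus_commute)
    qed
  qed
  from tendsto_add[OF this lim] have "(\<lambda>n. norm (x - a n)) \<longlonglongrightarrow> far_dist x A"
    by simp
  then have "a \<longlonglongrightarrow> p"
    by (intro maximizing_tendsto_farthest[OF assms(1,2) a(1) _ p])
  from tendsto_diff[OF this shadow] show ?thesis
    by simp
qed

theorem theorem2p5:
  fixes A :: "'a::real_normed_vector set"
  assumes "A \<noteq> {}" and "bounded A"
    and "uniquely_remotal A" and "M_compact A"
  shows "derived_set A = {} \<or> (M_compact (derived_set A) \<and> uniquely_remotal (derived_set A))"
proof -
  obtain q where q: "\<And>x. q x \<in> farthest_points x A"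
    using assms(3) unfolding uniquely_remotal_def by metis
  have derived_closure: "derived_set A \<subseteq> closure A"
    by (auto simp: derived_set_def closure_def)
  from singleton_or_farthest_points_islimpt[OF assms q] show ?thesis
  proof
    assume "\<exists>p. A = {p}"
    then have "derived_set A = {}"
      by (auto simp: derived_set_def islimpt_finite)
    then show ?thesis ..
  next
    assume "\<forall>x. q x islimpt A"
    then have q_derived: "q x \<in> derived_set A" for x
      by (simp add: derived_set_def)
    have q_dist: "norm (x - q x) = far_dist x A" for x
      using q[of x] by (simp add: farthest_points_def)
    have bounded_derived: "bounded (derived_set A)"
      using bounded_closure[OF assms(2)] derived_closure by (rule bounded_subset)
    have far_eq: "far_dist x (derived_set A) = far_dist x A" for x
    proof (rule antisym)
      have "norm (x - b) \<le> far_dist x A" if "b \<in> closure A" for b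
        by (rule continuous_le_on_closure[OF _ that])
          (auto intro!: continuous_intros norm_diff_le_far_dist assms(2))
      then show "far_dist x (derived_set A) \<le> far_dist x A"
        using q_derived derived_closure by (intro far_dist_leI) auto
      show "far_dist x A \<le> far_dist x (derived_set A)"
        using norm_diff_le_far_dist[OF bounded_derived q_derived[of x], of x] by (simp add: q_dist)
    qed
    have converges: "s \<longlonglongrightarrow> q x"
      if "\<And>n. s n \<in> derived_set A" "(\<lambda>n. norm (x - s n)) \<longlonglongrightarrow> far_dist x (derived_set A)" for s x
      using that derived_closure
      by (intro closure_maximizing_tendsto_farthest[OF assms(3,4) _ _ q]) (auto simp: far_eq)
    have "M_compact (derived_set A)"
      unfolding M_compact_def maximizing_seq_def
    proof clarify
      fix s x
      assume "\<forall>n. s n \<in> derived_set A" "(\<lambda>n. norm (x - s n)) \<longlonglongrightarrow> far_dist x (derived_set A)"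
      then have "(s \<circ> id) \<longlonglongrightarrow> q x"
        using converges by simp
      then show "\<exists>r l. strict_mono r \<and> l \<in> derived_set A \<and> (s \<circ> r) \<longlonglongrightarrow> l"
        using q_derived strict_mono_id by blast
    qed
    moreover have "uniquely_remotal (derived_set A)"
      unfolding uniquely_remotal_def
    proof (intro allI ex1I)
      fix x
      show "q x \<in> farthest_points x (derived_set A)"
        by (simp add: farthest_points_def q_derived far_eq q_dist)
      fix b assume "b \<in> farthest_points x (derived_set A)"
      then have "(\<lambda>n::nat. b) \<longlonglongrightarrow> q x"
        by (intro converges) (auto simp: farthest_points_def)
      then show "b = q x"
        by (simp add: LIMSEQ_const_iff)
    qed
    ultimately show ?thesis by blast
  qed
qed

end
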